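(* The only non-zero left-symmetric points of $\ell_\infty$ are the scalar multiples of $e_n$ for $n\in\mathbb{N}$; that is, a non-zero $x\in\ell_\infty$ is left-symmetric if and only if $x=ce_n$ for some $n\in\mathbb{N}$ and some $c\in\mathbb{K}$.
   Context: $\mathbb{K}$ is $\mathbb{R}$ or $\mathbb{C}$. $\ell_\infty$ is the space of bounded sequences in $\mathbb{K}$ with the supremum norm. In a normed space $\mathbb{X}$ over $\mathbb{K}$, $x\perp_B y$ means $\|x+\lambda y\|\ge\|x\|$ for all $\lambda\in\mathbb{K}$. A point $x\in\mathbb{X}$ is left-symmetric if for every $y\in\mathbb{X}$, $x\perp_B y$ implies $y\perp_B x$. $e_n$ is the sequence whose $n$-th term is $1$ and whose other terms are $0$. *)

theory Defs
  imports "HOL-Analysis.Analysis"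
begin

text \<open>
  A normed space over a normed field. The real normed structure on the type of vectors supplies
  addition and the norm; the scalar multiplication is a parameter, because \<open>'v\<close> has only
  real scalars built in.
\<close>

locale normed_space_over = vector_space scale
  for scale :: "'k::real_normed_field \<Rightarrow> 'v::real_normed_vector \<Rightarrow> 'v" +
  assumes norm_scale: "norm (scale c x) = norm c * norm x"
begin

definition birkhoff_orthogonal :: "'v \<Rightarrow> 'v \<Rightarrow> bool"
  where "birkhoff_orthogonal x y \<longleftrightarrow> (\<forall>c. norm (x + scale c y) \<ge> norm x)"

definition left_symmetric :: "'v \<Rightarrow> bool"
  where "left_symmetric x \<longleftrightarrow> (\<forall>y. birkhoff_orthogonal x y \<longrightarrow> birkhoff_orthogonal y x)"

end

text \<open>
  \<open>nat\<close> carries the discrete topology, so the bounded continuous functions on it are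
  exactly the bounded sequences, and the norm on \<open>\<Rightarrow>\<^sub>C\<close> is the supremum norm; see
  \<open>range_apply_linf\<close> and \<open>norm_linf\<close> below. Terms are indexed from 0.
\<close>

type_synonym 'k linf = "nat \<Rightarrow>\<^sub>C 'k"

lemma bcontfun_nat: "bcontfun = {f :: nat \<Rightarrow> 'k::metric_space. bounded (range f)}"
  by (auto simp: bcontfun_def)

lemma range_apply_linf:
  "range (apply_bcontfun :: 'k::metric_space linf \<Rightarrow> nat \<Rightarrow> 'k) = {f. bounded (range f)}"
  using type_definition.Rep_range[OF type_definition_bcontfun] bcontfun_nat by metis

lemma norm_linf: "norm x = (SUP n. norm (apply_bcontfun x n))"
  for x :: "'k::real_normed_vector linf"
  by (simp add: norm_bcontfun_def dist_bcontfun_def)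

definition linf_scale :: "'k::real_normed_field \<Rightarrow> 'k linf \<Rightarrow> 'k linf"
  where "linf_scale c x = Bcontfun (\<lambda>n. c * apply_bcontfun x n)"

definition linf_unit :: "nat \<Rightarrow> 'k::real_normed_field linf"
  where "linf_unit n = Bcontfun (\<lambda>k. if k = n then 1 else 0)"

lemma apply_linf_scale [simp]: "apply_bcontfun (linf_scale c x) n = c * apply_bcontfun x n"
proof -
  have "bounded (range (\<lambda>n. c * apply_bcontfun x n))"
    using bounded_linear_image[OF bounded_apply_bcontfun[of x] bounded_linear_mult_right[of c]]
    by (simp add: image_comp o_def)
  then show ?thesis
    by (simp add: linf_scale_def Bcontfun_inverse bcontfun_nat)
qed

lemma apply_linf_unit [simp]: "apply_bcontfun (linf_unit n) k = (if k = n then 1 else 0)"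
proof -
  have "bounded (range (\<lambda>k. if k = n then 1 else 0 :: 'a))"
    by (rule boundedI[of _ 1]) auto
  then show ?thesis
    by (simp add: linf_unit_def Bcontfun_inverse bcontfun_nat)
qed

lemma norm_linf_scale: "norm (linf_scale c x) = norm c * norm x"
proof (rule antisym)
  have le: "norm (linf_scale c x) \<le> norm c * norm x" for c :: 'a and x
    by (rule norm_bound) (simp add: norm_mult mult_left_mono norm_bounded)
  show "norm (linf_scale c x) \<le> norm c * norm x"
    by (rule le)
  show "norm c * norm x \<le> norm (linf_scale c x)"
  proof (cases "c = 0")
    case False
    then have "linf_scale (inverse c) (linf_scale c x) = x"
      by (auto intro: bcontfun_eqI simp: field_simps)
    then have "norm x \<le> inverse (norm c) * norm (linf_scale c x)"
      using le[of "inverse c" "linf_scale c x"] by (simp add: norm_inverse)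
    with False show ?thesis
      by (simp add: field_simps)
  qed simp
qed

interpretation linf: normed_space_over "linf_scale :: 'k::real_normed_field \<Rightarrow> 'k linf \<Rightarrow> 'k linf"
  by unfold_locales (auto intro!: bcontfun_eqI simp: algebra_simps norm_linf_scale)

end

theory Submission
  imports Defs
begin

text \<open>
  Everything comes from testing orthogonality against the unit sequences \<open>e\<^sub>j\<close>, where both
  directions have a transparent meaning. On one side, \<open>e\<^sub>j \<perp> y\<close> iff \<open>y\<^sub>j = 0\<close>, because \<open>e\<^sub>j\<close> attains its
  norm only at \<open>j\<close> and its other terms stay far below it
  (\<open>scaled_unit_orthogonal_iff\<close>). On the other side, \<open>x \<perp> e\<^sub>j\<close> iff deleting the \<open>j\<close>-th term of
  \<open>x\<close> does not lower its norm, because adding multiples of \<open>e\<^sub>j\<close> can change nothing but that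
  term (\<open>orthogonal_scaled_unit_iff\<close>).

  If \<open>e\<^sub>n \<perp> y\<close>, then \<open>y\<^sub>n = 0\<close>, so deleting the \<open>n\<close>-th term of \<open>y\<close> changes nothing and
  \<open>y \<perp> e\<^sub>n\<close>; hence the multiples of \<open>e\<^sub>n\<close> are left-symmetric. Conversely, left-symmetry of \<open>x\<close>
  applied to \<open>e\<^sub>j\<close> says that deleting any non-zero term lowers the norm. Then the norm is attained at
  every non-zero term, so two non-zero terms are impossible: deleting one of them would leave the
  norm attained at the other.

  Nothing distinguishes the real from the complex scalars here: all that enters is that the absolute
  value is multiplicative and that reals embed as scalars, so both cases are instances of the result
  over an arbitrary real normed field.
\<close>

definition erase_term :: "nat \<Rightarrow> 'k::real_normed_field linf \<Rightarrow> 'k linf"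
  where "erase_term j x = x - linf_scale (apply_bcontfun x j) (linf_unit j)"

lemma apply_erase_term [simp]:
  "apply_bcontfun (erase_term j x) k = (if k = j then 0 else apply_bcontfun x k)"
  by (simp add: erase_term_def)

lemma norm_le_max_erase_term:
  "norm x \<le> max (norm (apply_bcontfun x j)) (norm (erase_term j x))"
proof (rule norm_bound)
  fix k
  show "norm (apply_bcontfun x k) \<le> max (norm (apply_bcontfun x j)) (norm (erase_term j x))"
    using norm_bounded[of "erase_term j x" k] by (cases "k = j") auto
qed

lemma norm_scaled_unit: "norm (linf_scale c (linf_unit j)) = norm c"
proof (rule antisym)
  show "norm (linf_scale c (linf_unit j)) \<le> norm c"
    by (rule norm_bound) simp
  show "norm c \<le> norm (linf_scale c (linf_unit j))"
    using norm_bounded[of "linf_scale c (linf_unit j)" j] by simp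
qed

text \<open>
  Among all perturbations of \<open>x\<close> in its \<open>j\<close>-th term, the one that makes this term zero has the least
  norm, so orthogonality need only be tested on it.
\<close>

lemma orthogonal_scaled_unit_iff:
  assumes "c \<noteq> 0"
  shows "linf.birkhoff_orthogonal x (linf_scale c (linf_unit j)) \<longleftrightarrow> norm x \<le> norm (erase_term j x)"
proof
  assume orth: "linf.birkhoff_orthogonal x (linf_scale c (linf_unit j))"
  have "erase_term j x = x + linf_scale (- apply_bcontfun x j / c) (linf_scale c (linf_unit j))"
    using assms by (intro bcontfun_eqI) simp
  with orth show "norm x \<le> norm (erase_term j x)"
    unfolding linf.birkhoff_orthogonal_def by metis
next
  assume le: "norm x \<le> norm (erase_term j x)"
  have "norm (erase_term j x) \<le> norm (x + linf_scale d (linf_scale c (linf_unit j)))" (is "_ \<le> norm ?z")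
    for d
  proof (rule norm_bound)
    fix k
    show "norm (apply_bcontfun (erase_term j x) k) \<le> norm ?z"
      using norm_bounded[of ?z k] by (cases "k = j") auto
  qed
  with le show "linf.birkhoff_orthogonal x (linf_scale c (linf_unit j))"
    by (auto simp: linf.birkhoff_orthogonal_def intro: order_trans)
qed

text \<open>
  If \<open>y\<^sub>j \<noteq> 0\<close>, a small multiple of \<open>y\<close> lowers the \<open>j\<close>-th term of \<open>c e\<^sub>j\<close> while the boundedness of \<open>y\<close>
  keeps all other terms below \<open>\<bar>c\<bar>\<close>; if \<open>y\<^sub>j = 0\<close>, the \<open>j\<close>-th term alone witnesses the norm \<open>\<bar>c\<bar>\<close>.
\<close>

lemma scaled_unit_orthogonal_iff:
  assumes "c \<noteq> 0"
  shows "linf.birkhoff_orthogonal (linf_scale c (linf_unit j)) y \<longleftrightarrow> apply_bcontfun y j = 0"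
proof
  assume orth: "linf.birkhoff_orthogonal (linf_scale c (linf_unit j)) y"
  show "apply_bcontfun y j = 0"
  proof (rule ccontr)
    assume y_j: "apply_bcontfun y j \<noteq> 0"
    have y_j_le: "norm (apply_bcontfun y j) \<le> norm y"
      by (rule norm_bounded)
    with y_j have norm_y: "norm y > 0"
      by (metis less_le_trans zero_less_norm_iff)
    \<comment> \<open>With this \<open>t\<close>, the other terms of the perturbed sequence are at most \<open>\<bar>c\<bar> / 2\<close>.\<close>
    define t where "t = norm (apply_bcontfun y j) / (2 * norm y)"
    have "t > 0"
      using y_j norm_y by (simp add: t_def)
    moreover have "t \<le> 1 / 2"
      using y_j_le norm_y by (simp add: t_def divide_le_eq)
    ultimately have t: "0 < t" "t < 1"
      by simp_all
    define d where "d = - (of_real t * c / apply_bcontfun y j)"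
    have norm_d: "norm d * norm y = norm c / 2"
      using y_j norm_y by (simp add: d_def t_def norm_mult norm_divide)
    let ?z = "linf_scale c (linf_unit j) + linf_scale d y"
    have "norm ?z \<le> max ((1 - t) * norm c) (norm c / 2)"
    proof (rule norm_bound)
      fix k
      show "norm (apply_bcontfun ?z k) \<le> max ((1 - t) * norm c) (norm c / 2)"
      proof (cases "k = j")
        case True
        have "apply_bcontfun ?z j = of_real (1 - t) * c"
          using y_j by (simp add: d_def algebra_simps)
        then have "norm (apply_bcontfun ?z j) = (1 - t) * norm c"
          using t by (simp only: norm_mult norm_of_real)
        with True show ?thesis
          by simp
      next
        case False
        then have "norm (apply_bcontfun ?z k) = norm d * norm (apply_bcontfun y k)"
          by (simp add: norm_mult)
        also have "\<dots> \<le> norm d * norm y"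
          by (intro mult_left_mono norm_bounded) simp
        finally show ?thesis
          using norm_d by simp
      qed
    qed
    also have "\<dots> < norm c"
      using t assms by simp
    finally show False
      using orth by (auto simp: linf.birkhoff_orthogonal_def norm_scaled_unit not_le[symmetric])
  qed
next
  assume y_j: "apply_bcontfun y j = 0"
  have "norm c \<le> norm (linf_scale c (linf_unit j) + linf_scale d y)" for d
    using norm_bounded[of "linf_scale c (linf_unit j) + linf_scale d y" j] y_j by simp
  then show "linf.birkhoff_orthogonal (linf_scale c (linf_unit j)) y"
    by (simp add: linf.birkhoff_orthogonal_def norm_scaled_unit)
qed

lemma left_symmetric_scaled_unit:
  assumes "c \<noteq> 0"
  shows "linf.left_symmetric (linf_scale c (linf_unit n))"
  unfolding linf.left_symmetric_def
proof (intro allI impI)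
  fix y
  assume "linf.birkhoff_orthogonal (linf_scale c (linf_unit n)) y"
  then have "apply_bcontfun y n = 0"
    using assms by (simp add: scaled_unit_orthogonal_iff)
  then have "erase_term n y = y"
    by (intro bcontfun_eqI) simp
  then show "linf.birkhoff_orthogonal y (linf_scale c (linf_unit n))"
    using assms by (simp add: orthogonal_scaled_unit_iff)
qed

text \<open>
  Otherwise \<open>x \<perp> e\<^sub>j\<close>, and left-symmetry would give \<open>e\<^sub>j \<perp> x\<close>, that is \<open>x\<^sub>j = 0\<close>.
\<close>

lemma left_symmetric_norm_erase_term_less:
  assumes "linf.left_symmetric x" and "apply_bcontfun x j \<noteq> 0"
  shows "norm (erase_term j x) < norm x"
proof (rule ccontr)
  assume "\<not> norm (erase_term j x) < norm x"
  then have "linf.birkhoff_orthogonal x (linf_scale 1 (linf_unit j))"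
    by (subst orthogonal_scaled_unit_iff) simp_all
  with assms(1) have "linf.birkhoff_orthogonal (linf_scale 1 (linf_unit j)) x"
    by (simp only: linf.left_symmetric_def)
  with assms(2) show False
    by (subst (asm) scaled_unit_orthogonal_iff) simp_all
qed

lemma left_symmetric_nonzero_term_unique:
  assumes sym: "linf.left_symmetric x"
    and i: "apply_bcontfun x i \<noteq> 0" and j: "apply_bcontfun x j \<noteq> 0"
  shows "i = j"
proof (rule ccontr)
  assume "i \<noteq> j"
  have "norm x \<le> norm (apply_bcontfun x j)"
    using norm_le_max_erase_term[of x j] left_symmetric_norm_erase_term_less[OF sym j] by simp
  also have "\<dots> \<le> norm (erase_term i x)"
    using norm_bounded[of "erase_term i x" j] \<open>i \<noteq> j\<close> by simp
  also have "\<dots> < norm x"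
    by (rule left_symmetric_norm_erase_term_less[OF sym i])
  finally show False
    by simp
qed

theorem left_symmetric_linf_iff:
  fixes x :: "'k::real_normed_field linf"
  assumes "x \<noteq> 0"
  shows "linf.left_symmetric x \<longleftrightarrow> (\<exists>n c. x = linf_scale c (linf_unit n))"
proof
  assume sym: "linf.left_symmetric x"
  from assms obtain n where n: "apply_bcontfun x n \<noteq> 0"
    by (metis bcontfun_eqI zero_bcontfun.rep_eq)
  have "x = linf_scale (apply_bcontfun x n) (linf_unit n)"
    using left_symmetric_nonzero_term_unique[OF sym n] by (intro bcontfun_eqI) auto
  then show "\<exists>n c. x = linf_scale c (linf_unit n)"
    by blast
next
  assume "\<exists>n c. x = linf_scale c (linf_unit n)"
  then obtain n c where x: "x = linf_scale c (linf_unit n)"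
    by blast
  with assms have "c \<noteq> 0"
    by auto
  with x show "linf.left_symmetric x"
    by (simp add: left_symmetric_scaled_unit)
qed

theorem theorem2p9:
  shows "(\<forall>x :: real linf. x \<noteq> 0 \<longrightarrow>
            (linf.left_symmetric x \<longleftrightarrow> (\<exists>n c. x = linf_scale c (linf_unit n)))) \<and>
         (\<forall>x :: complex linf. x \<noteq> 0 \<longrightarrow>
            (linf.left_symmetric x \<longleftrightarrow> (\<exists>n c. x = linf_scale c (linf_unit n))))"
  by (simp add: left_symmetric_linf_iff)

end
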